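(* Let $\Sigma$ be the discrete-time linear time-invariant system $x(t+1)=Ax(t)+Bu(t)+Ed(t)$, $y(t)=Cx(t)+Du(t)+Fd(t)$, $t\in\mathbb{Z}_+$, with $x(t)\in\mathbb{R}^n$, $u(t)\in\mathbb{R}^m$, $y(t)\in\mathbb{R}^p$, $d(t)\in\mathbb{R}^r$, real matrices $A,B,C,D,E,F$, and $\begin{bmatrix} E \\ F \end{bmatrix}\in\mathbb{R}^{(n+p)\times r}$ of full column rank $r$. Let $\hat\Sigma$ be the system $z(t+1)=A_{UIO}z(t)+B^u_{UIO}u(t)+B^y_{UIO}y(t)$, $\hat x(t)=z(t)+D^u_{UIO}u(t)+D^y_{UIO}y(t)$, $t\in\mathbb{Z}_+$, with $z(t),\hat x(t)\in\mathbb{R}^n$ and real matrices $A_{UIO},B^u_{UIO},B^y_{UIO},D^u_{UIO},D^y_{UIO}$. The following facts are equivalent. (i) $\hat\Sigma$ is an unknown-input observer (UIO) for $\Sigma$. (ii) The following two conditions hold: (a) $\mathcal{P}_{(x,u,y)}\mathcal{B}_\Sigma\subseteq\mathcal{P}_{(\hat x,u,y)}\mathcal{B}_{\hat\Sigma}$; and (b) the behavior $\mathcal{B}_e=\ker(\sigma I_n-A_{UIO})$ is autonomous and asymptotically stable. (iii) $A_{UIO}$ is Schur stable and $$\begin{bmatrix} -D^y_{UIO} & A_{UIO}D^y_{UIO}-B^y_{UIO} \end{bmatrix}\begin{bmatrix} CE & F \\ F & 0 \end{bmatrix}=\begin{bmatrix} -E & 0 \end{bmatrix},$$ $$A_{UIO}=A+\begin{bmatrix}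 -D^y_{UIO} & A_{UIO}D^y_{UIO}-B^y_{UIO} \end{bmatrix}\begin{bmatrix} CA \\ C \end{bmatrix},$$ $$\begin{bmatrix} B^u_{UIO} \\ D^u_{UIO} \end{bmatrix}=\begin{bmatrix} I_n-D^y_{UIO}C & -B^y_{UIO} \\ 0 & -D^y_{UIO} \end{bmatrix}\begin{bmatrix} B \\ D \end{bmatrix}.$$
   Context: All trajectories are defined on $\mathbb{Z}_+=\{0,1,2,\dots\}$. The behavior $\mathcal{B}_\Sigma$ is the set of all trajectories $(x,u,y,d)$ satisfying the equations of $\Sigma$ for all $t\in\mathbb{Z}_+$, and $\mathcal{B}_{\hat\Sigma}$ is the set of all trajectories $(\hat x,u,y,z)$ satisfying the equations of $\hat\Sigma$ for all $t\in\mathbb{Z}_+$. The projections are $\mathcal{P}_{(x,u,y)}\mathcal{B}_\Sigma=\{(x,u,y):\exists d,\ (x,u,y,d)\in\mathcal{B}_\Sigma\}$ and $\mathcal{P}_{(\hat x,u,y)}\mathcal{B}_{\hat\Sigma}=\{(\hat x,u,y):\exists z,\ (\hat x,u,y,z)\in\mathcal{B}_{\hat\Sigma}\}$. $\hat\Sigma$ is an acceptor for $\Sigma$ if for every $(x,u,y,d)$ satisfying $\Sigma$ there exists $z$ such that $(\hat x=x,u,y,z)$ satisfies $\hat\Sigma$. $\hat\Sigma$ is a UIO for $\Sigma$ if it is an acceptor and, when $\hat\Sigma$ is driven by the input $u$ and output $y$ of $\Sigma$, the error $e(t)=x(t)-\hat x(t)$ tends to $0$ as $t\to+\infty$ for every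 $x(0)$, $z(0)$, every input $u$ and every unknown input $d$. $\sigma$ is the left shift, $(\sigma w)(t)=w(t+1)$; for a polynomial matrix $R(z)=\sum_{i=0}^L R_iz^i$, $\ker(R(\sigma))$ is the set of trajectories $w$ on $\mathbb{Z}_+$ with $\sum_i R_iw(t+i)=0$ for all $t\in\mathbb{Z}_+$; such a set is called a behavior. A behavior is autonomous if there is $l\in\mathbb{Z}_+$ such that each of its trajectories is uniquely determined by its first $l$ samples; an autonomous behavior is asymptotically stable if all its trajectories converge to $0$ as $t\to+\infty$. A real square matrix is Schur (stable) if all its eigenvalues have modulus less than $1$. *)

theory Defs
  imports
    Complex_Main
    "Jordan_Normal_Form.Char_Poly"
    "Jordan_Normal_Form.DL_Rank"
begin

type_synonym trajectory = "nat \<Rightarrow> real vec"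

definition trajectories :: "nat \<Rightarrow> trajectory set" where
  "trajectories k = {w. \<forall>t. w t \<in> carrier_vec k}"

text \<open>The Euclidean norm of \<open>w t\<close> tends to 0; this is convergence to 0 in \<open>\<real>\<^sup>k\<close>
  for trajectories in \<^term>\<open>trajectories k\<close>.\<close>

definition tends_to_zero :: "trajectory \<Rightarrow> bool" where
  "tends_to_zero w \<longleftrightarrow> (\<lambda>t. sqrt (w t \<bullet> w t)) \<longlonglongrightarrow> 0"


definition plant_behavior ::
  "real mat \<Rightarrow> real mat \<Rightarrow> real mat \<Rightarrow> real mat \<Rightarrow> real mat \<Rightarrow> real mat
    \<Rightarrow> (trajectory \<times> trajectory \<times> trajectory \<times> trajectory) set" where
  "plant_behavior A B C D E F = {(x, u, y, d).
      x \<in> trajectories (dim_row A) \<and> u \<in> trajectories (dim_col B) \<and>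
      y \<in> trajectories (dim_row C) \<and> d \<in> trajectories (dim_col E) \<and>
      (\<forall>t. x (t + 1) = A *\<^sub>v x t + B *\<^sub>v u t + E *\<^sub>v d t \<and>
           y t = C *\<^sub>v x t + D *\<^sub>v u t + F *\<^sub>v d t)}"

definition observer_behavior ::
  "real mat \<Rightarrow> real mat \<Rightarrow> real mat \<Rightarrow> real mat \<Rightarrow> real mat
    \<Rightarrow> (trajectory \<times> trajectory \<times> trajectory \<times> trajectory) set" where
  "observer_behavior AU Bu By Du Dy = {(xh, u, y, z).
      xh \<in> trajectories (dim_row AU) \<and> u \<in> trajectories (dim_col Bu) \<and>
      y \<in> trajectories (dim_col By) \<and> z \<in> trajectories (dim_row AU) \<and>
      (\<forall>t. z (t + 1) = AU *\<^sub>v z t + Bu *\<^sub>v u t + By *\<^sub>v y t \<and>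
           xh t = z t + Du *\<^sub>v u t + Dy *\<^sub>v y t)}"

text \<open>Elimination of the last component of a set of quadruples of trajectories.\<close>

definition proj3 ::
  "(trajectory \<times> trajectory \<times> trajectory \<times> trajectory) set
    \<Rightarrow> (trajectory \<times> trajectory \<times> trajectory) set" where
  "proj3 S = {(a, b, c). \<exists>v. (a, b, c, v) \<in> S}"

definition acceptor ::
  "real mat \<Rightarrow> real mat \<Rightarrow> real mat \<Rightarrow> real mat \<Rightarrow> real mat \<Rightarrow> real mat
    \<Rightarrow> real mat \<Rightarrow> real mat \<Rightarrow> real mat \<Rightarrow> real mat \<Rightarrow> real mat \<Rightarrow> bool" where
  "acceptor A B C D E F AU Bu By Du Dy \<longleftrightarrow>
    (\<forall>x u y d. (x, u, y, d) \<in> plant_behavior A B C D E F \<longrightarrow>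
      (\<exists>z. (x, u, y, z) \<in> observer_behavior AU Bu By Du Dy))"

text \<open>Both systems have a unique solution for every choice of the initial states and of
  \<open>u\<close> and \<open>d\<close>, so the second conjunct ranges over all \<open>x(0)\<close>, \<open>z(0)\<close>, \<open>u\<close>, \<open>d\<close>; the two
  systems share \<open>u\<close> and \<open>y\<close>.\<close>

definition unknown_input_observer ::
  "real mat \<Rightarrow> real mat \<Rightarrow> real mat \<Rightarrow> real mat \<Rightarrow> real mat \<Rightarrow> real mat
    \<Rightarrow> real mat \<Rightarrow> real mat \<Rightarrow> real mat \<Rightarrow> real mat \<Rightarrow> real mat \<Rightarrow> bool" where
  "unknown_input_observer A B C D E F AU Bu By Du Dy \<longleftrightarrow>
    acceptor A B C D E F AU Bu By Du Dy \<and>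
    (\<forall>x u y d xh z. (x, u, y, d) \<in> plant_behavior A B C D E F \<longrightarrow>
      (xh, u, y, z) \<in> observer_behavior AU Bu By Du Dy \<longrightarrow>
      tends_to_zero (\<lambda>t. x t - xh t))"


definition coeff_mat :: "real poly mat \<Rightarrow> nat \<Rightarrow> real mat" where
  "coeff_mat R i = map_mat (\<lambda>q. coeff q i) R"

definition degree_mat :: "real poly mat \<Rightarrow> nat" where
  "degree_mat R = Max (insert 0 (degree ` elements_mat R))"

text \<open>Kernel of \<open>R(\<sigma>)\<close> with \<open>\<sigma>\<close> the left shift.\<close>

definition ker_shift :: "real poly mat \<Rightarrow> trajectory set" where
  "ker_shift R = {w \<in> trajectories (dim_col R). \<forall>t.
      finsum_vec TYPE(real) (dim_row R) (\<lambda>i. coeff_mat R i *\<^sub>v w (t + i)) {..degree_mat R}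
        = 0\<^sub>v (dim_row R)}"

definition autonomous :: "trajectory set \<Rightarrow> bool" where
  "autonomous S \<longleftrightarrow> (\<exists>l. \<forall>w\<in>S. \<forall>v\<in>S. (\<forall>t<l. w t = v t) \<longrightarrow> w = v)"

definition asymptotically_stable :: "trajectory set \<Rightarrow> bool" where
  "asymptotically_stable S \<longleftrightarrow> (\<forall>w\<in>S. tends_to_zero w)"

text \<open>The polynomial matrix \<^term>\<open>char_poly_matrix M\<close> is \<open>z I - M\<close>.\<close>

definition error_behavior :: "real mat \<Rightarrow> trajectory set" where
  "error_behavior M = ker_shift (char_poly_matrix M)"

definition schur_stable :: "real mat \<Rightarrow> bool" where
  "schur_stable M \<longleftrightarrow>
    (\<forall>k. eigenvalue (map_mat complex_of_real M) k \<longrightarrow> cmod k < 1)"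


text \<open>The block matrix \<open>[M N]\<close>; the vertical counterpart is \<^const>\<open>append_rows\<close>.\<close>

definition block_row :: "real mat \<Rightarrow> real mat \<Rightarrow> real mat" where
  "block_row M N = four_block_mat M N (0\<^sub>m 0 (dim_col M)) (0\<^sub>m 0 (dim_col N))"

end

theory Submission
  imports Defs "Jordan_Normal_Form.Spectral_Radius"
begin

text \<open>The difference of two observer trajectories with the same input and output evolves
  freely under \<open>AU\<close>. If the observer is an acceptor, one of them reproduces the plant state, so
  every estimation error lies in \<open>ker (\<sigma> I - AU)\<close>; conversely, with zero plant signals every
  element of this kernel occurs as an error. Hence being a UIO means being an acceptor with
  asymptotically stable error behavior, and the latter is the Schur property of \<open>AU\<close>.
  For an acceptor the observer state must be \<open>x - Du u - Dy y\<close>; substituting this in the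
  observer recursion and comparing the coefficients of the independent vectors \<open>x(t)\<close>, \<open>u(t)\<close>,
  \<open>d(t)\<close>, \<open>u(t+1)\<close>, \<open>d(t+1)\<close> gives the matrix equations.\<close>

section \<open>Convergence to zero, and the error behavior as a recurrence\<close>

text \<open>Each component is bounded by the Euclidean norm, and the squared norm is a finite sum of
  squared components, so either kind of convergence yields the other.\<close>

lemma tends_to_zero_iff_components:
  assumes w: "w \<in> trajectories n"
  shows "tends_to_zero w \<longleftrightarrow> (\<forall>i<n. (\<lambda>t. w t $ i) \<longlonglongrightarrow> 0)"
proof
  have sq: "w t \<bullet> w t = (\<Sum>j<n. (w t $ j)\<^sup>2)" for t
  proof -
    have "w t \<in> carrier_vec n" using w by (simp add: trajectories_def)
    then show ?thesis
      using carrier_vecD[of "w t" n] by (simp add: scalar_prod_def power2_eq_square lessThan_atLeast0)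
  qed
  {
    assume lim: "tends_to_zero w"
    show "\<forall>i<n. (\<lambda>t. w t $ i) \<longlonglongrightarrow> 0"
    proof (intro allI impI)
      fix i assume i: "i < n"
      have bound: "\<bar>w t $ i\<bar> \<le> sqrt (w t \<bullet> w t)" for t
      proof -
        have "(w t $ i)\<^sup>2 \<le> w t \<bullet> w t"
          unfolding sq using i by (intro member_le_sum) auto
        then show ?thesis by (metis real_sqrt_abs real_sqrt_le_mono)
      qed
      have "norm (w t $ i) \<le> norm (sqrt (w t \<bullet> w t)) * 1" for t
        using order_trans[OF bound abs_ge_self] by simp
      with lim show "(\<lambda>t. w t $ i) \<longlonglongrightarrow> 0"
        unfolding tends_to_zero_def by (rule tendsto_0_le[OF _ always_eventually[OF allI]])
    qed
  }
  {
    assume lim: "\<forall>i<n. (\<lambda>t. w t $ i) \<longlonglongrightarrow> 0"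
    have "(\<lambda>t. \<Sum>j<n. (w t $ j)\<^sup>2) \<longlonglongrightarrow> (\<Sum>j<n. 0\<^sup>2)"
      using lim by (intro tendsto_sum tendsto_power) auto
    from tendsto_real_sqrt[OF this] show "tends_to_zero w"
      unfolding tends_to_zero_def sq by simp
  }
qed

lemma coeff_char_poly_matrix:
  assumes M: "M \<in> carrier_mat n n"
  shows "coeff_mat (char_poly_matrix M) 0 = - M"
    and "coeff_mat (char_poly_matrix M) (Suc 0) = 1\<^sub>m n"
  using M by (auto simp: coeff_mat_def char_poly_matrix_def intro!: eq_matI)

text \<open>Off-diagonal entries are constants and diagonal ones are monic of degree 1, so the
  maximum is attained on the diagonal. The empty matrix has degree 0, hence the condition
  \<open>n > 0\<close>.\<close>

lemma degree_mat_char_poly_matrix: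
  assumes M: "M \<in> carrier_mat n n" and n: "n > 0"
  shows "degree_mat (char_poly_matrix M) = 1"
proof -
  let ?R = "char_poly_matrix M"
  have R: "?R \<in> carrier_mat n n" using M by simp
  have entry: "?R $$ (i, j) = (if i = j then [:- M $$ (i, j), 1:] else [:- M $$ (i, j):])"
    if "i < n" "j < n" for i j
    using that M by (auto simp: char_poly_matrix_def)
  have le: "degree q \<le> 1" if "q \<in> elements_mat ?R" for q
  proof -
    from that obtain i j where "i < n" "j < n" "q = ?R $$ (i, j)"
      using R by (auto dest!: elements_matD)
    then show ?thesis using entry[of i j] by (auto split: if_splits)
  qed
  have "?R $$ (0, 0) \<in> elements_mat ?R" using R n by (intro elements_matI[of _ n n 0 0]) auto
  moreover have "degree (?R $$ (0, 0)) = 1" using entry[OF n n] by simp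
  ultimately have "1 \<in> degree ` elements_mat ?R" by (metis image_eqI)
  then show ?thesis unfolding degree_mat_def using le
    by (intro Max_eqI) (auto simp: elements_mat_def)
qed

text \<open>The coefficients of \<open>char_poly_matrix M\<close> at 0 and 1 are \<open>- M\<close>
  and \<open>1\<^sub>m n\<close>, so the kernel condition at time \<open>t\<close> reads
  \<open>w (Suc t) - M *\<^sub>v w t = 0\<^sub>v n\<close>.\<close>

lemma error_behavior_eq:
  assumes M: "M \<in> carrier_mat n n"
  shows "error_behavior M = {w \<in> trajectories n. \<forall>t. w (Suc t) = M *\<^sub>v w t}"
proof -
  let ?R = "char_poly_matrix M"
  let ?f = "\<lambda>w t. finsum_vec TYPE(real) n (\<lambda>i. coeff_mat ?R i *\<^sub>v w (t + i)) {..degree_mat ?R}"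
  have R: "?R \<in> carrier_mat n n" using M by simp
  have "?f w t = 0\<^sub>v n \<longleftrightarrow> w (Suc t) = M *\<^sub>v w t" if "w \<in> trajectories n" for w t
  proof -
    have w: "w s \<in> carrier_vec n" for s using that by (simp add: trajectories_def)
    have c: "coeff_mat ?R i *\<^sub>v w (t + i) \<in> carrier_vec n" for i
      using R w by (intro mult_mat_vec_carrier[of _ n n]) (auto simp: coeff_mat_def)
    then have fc: "?f w t \<in> carrier_vec n" by (intro finsum_vec_closed) auto
    have "?f w t $ i = (w (Suc t) - M *\<^sub>v w t) $ i" if i: "i < n" for i
    proof -
      have "?f w t $ i = (\<Sum>j\<in>{..degree_mat ?R}. (coeff_mat ?R j *\<^sub>v w (t + j)) $ i)"
        using i c by (intro index_finsum_vec) auto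
      \<comment> \<open>A component index \<open>i < n\<close> forces \<open>n > 0\<close>, so the
        degree is 1 and the sum has exactly two terms; in dimension 0 there is no component to
        compare.\<close>
      also have "\<dots> = (\<Sum>j\<in>{0, Suc 0}. (coeff_mat ?R j *\<^sub>v w (t + j)) $ i)"
        using degree_mat_char_poly_matrix[OF M] i by (intro sum.cong) auto
      also have "(\<Sum>j\<in>{0, Suc 0}. (coeff_mat ?R j *\<^sub>v w (t + j)) $ i)
          = (- M *\<^sub>v w t) $ i + (1\<^sub>m n *\<^sub>v w (Suc t)) $ i"
        by (simp add: coeff_char_poly_matrix[OF M])
      also have "\<dots> = (w (Suc t) - M *\<^sub>v w t) $ i"
        using i M w[of t] w[of "Suc t"] by simp
      finally show ?thesis .
    qed
    then have "?f w t = w (Suc t) - M *\<^sub>v w t"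
      using fc M w by (intro eq_vecI) auto
    moreover have "M *\<^sub>v w t \<in> carrier_vec n" using M w by simp
    ultimately show ?thesis using w[of "Suc t"] by (auto simp: vec_eq_iff)
  qed
  then show ?thesis
    using R unfolding error_behavior_def ker_shift_def by auto
qed

text \<open>The recurrence is of first order, so the single sample at time 0 determines the whole
  trajectory; hence the choice 1 for the number of samples.\<close>

lemma autonomous_error_behavior:
  assumes M: "M \<in> carrier_mat n n"
  shows "autonomous (error_behavior M)"
  unfolding autonomous_def
proof (intro exI[of _ 1] ballI impI ext)
  fix w v t
  assume "w \<in> error_behavior M" "v \<in> error_behavior M" "\<forall>t<1. w t = v t"
  then show "w t = v t" by (induction t) (auto simp: error_behavior_eq[OF M])
qed

section \<open>Schur stability of a matrix and decay of its trajectories\<close>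

lemma linear_recurrence_pow:
  fixes N :: "'a :: comm_ring_1 mat"
  assumes N: "N \<in> carrier_mat n n" and w: "\<And>t. w t \<in> carrier_vec n"
    and step: "\<And>t. w (Suc t) = N *\<^sub>v w t"
  shows "w t = N ^\<^sub>m t *\<^sub>v w 0"
  using w step
proof (induction t arbitrary: w)
  case 0
  then show ?case using N by simp
next
  case (Suc t)
  \<comment> \<open>A power gains its new factor on the right, next to the initial vector, so the
    induction hypothesis is applied to the trajectory shifted by one.\<close>
  have "w (Suc t) = N ^\<^sub>m t *\<^sub>v w (Suc 0)" using Suc by (intro Suc.IH[of "\<lambda>s. w (Suc s)"]) blast+
  also have "\<dots> = N ^\<^sub>m Suc t *\<^sub>v w 0"
    using N Suc.prems by (simp add: assoc_mult_mat_vec[of _ n n _ n])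
  finally show ?case .
qed

text \<open>Supplies a radius strictly between the eigenvalue moduli and 1. The midpoint of 1 and
  the largest element works; inserting 0 covers the empty set and makes the radius positive, so that
  one can divide by it.\<close>

lemma finite_max_less_one:
  fixes S :: "real set"
  assumes "finite S" "\<forall>x\<in>S. x < 1"
  obtains \<rho> where "0 < \<rho>" "\<rho> < 1" "\<forall>x\<in>S. x < \<rho>"
proof -
  let ?m = "Max (insert 0 S)"
  have "?m < 1" "0 \<le> ?m" "\<forall>x\<in>S. x \<le> ?m" using assms by auto
  then show ?thesis using that[of "(?m + 1) / 2"] by fastforce
qed

text \<open>For \<open>n > 0\<close> the spectral radius is attained at an eigenvalue.\<close>

lemma spectral_radius_less_1I:
  assumes N: "N \<in> carrier_mat n n" and n: "n > 0"
    and ev: "\<And>k. eigenvalue N k \<Longrightarrow> cmod k < 1"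
  shows "spectral_radius N < 1"
  using spectral_radius_mem_max(1)[OF N n] ev by (auto simp: spectrum_def)

text \<open>Rescaling the trajectory by \<open>\<rho>\<close> to the power \<open>-t\<close>, with \<open>\<rho> < 1\<close> above every
  eigenvalue modulus, leaves it bounded, so the original one decays like \<open>\<rho>\<close> to the power \<open>t\<close>.\<close>

lemma schur_stable_imp_tends_to_zero:
  assumes M: "M \<in> carrier_mat n n" and stable: "schur_stable M"
    and w: "w \<in> trajectories n" and step: "\<And>t. w (Suc t) = M *\<^sub>v w t"
  shows "tends_to_zero w"
proof (cases "n = 0")
  case True
  then show ?thesis using tends_to_zero_iff_components[OF w] by simp
next
  case False
  then have n: "n > 0" by simp
  let ?h = complex_of_real
  let ?M = "map_mat ?h M"
  have cM: "?M \<in> carrier_mat n n" using M by simp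
  have "finite (spectrum ?M)"
    using card_finite_spectrum(1)[OF cM] .
  then have "finite (cmod ` spectrum ?M)" by simp
  moreover have "\<forall>x\<in>cmod ` spectrum ?M. x < 1"
    using stable by (auto simp: schur_stable_def spectrum_def)
  ultimately obtain \<rho> where \<rho>: "0 < \<rho>" "\<rho> < 1" and ev: "\<forall>x\<in>cmod ` spectrum ?M. x < \<rho>"
    using finite_max_less_one by metis
  \<comment> \<open>The eigenvalues of \<open>N\<close> are those of \<open>?M\<close> divided by
    \<open>\<rho>\<close>. Their moduli are below 1, whence all powers of \<open>N\<close> are
    bounded entrywise by one constant.\<close>
  define N where "N = ?h (inverse \<rho>) \<cdot>\<^sub>m ?M"
  have N: "N \<in> carrier_mat n n" unfolding N_def using cM by simp
  have smult: "N *\<^sub>v v = ?h (inverse \<rho>) \<cdot>\<^sub>v (?M *\<^sub>v v)" if "v \<in> carrier_vec n" for v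
    unfolding N_def using that M by (intro eq_vecI) auto
  have "cmod k < 1" if k: "eigenvalue N k" for k
  proof -
    from k obtain v where v: "v \<in> carrier_vec n" "v \<noteq> 0\<^sub>v n" "N *\<^sub>v v = k \<cdot>\<^sub>v v"
      using N by (auto simp: eigenvalue_def eigenvector_def)
    have "?M *\<^sub>v v = ?h \<rho> \<cdot>\<^sub>v (N *\<^sub>v v)"
      unfolding smult[OF v(1)] using \<rho> by (simp add: smult_smult_assoc flip: of_real_mult)
    also have "\<dots> = (?h \<rho> * k) \<cdot>\<^sub>v v" unfolding v(3) by (simp add: smult_smult_assoc)
    finally have "?h \<rho> * k \<in> spectrum ?M"
      using v(1,2) M by (auto simp: spectrum_def eigenvalue_def eigenvector_def)
    then have "cmod (?h \<rho> * k) < \<rho>" using ev by blast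
    then show ?thesis using \<rho> by (simp add: norm_mult)
  qed
  then have "spectral_radius N < 1" by (rule spectral_radius_less_1I[OF N n])
  from spectral_radius_jnf_norm_bound_less_1_upper_triangular[OF N this]
  obtain c where c: "\<And>k. norm_bound (N ^\<^sub>m k) c" by blast
  define v where "v t = ?h (inverse \<rho> ^ t) \<cdot>\<^sub>v map_vec ?h (w t)" for t
  have wc: "w t \<in> carrier_vec n" for t using w by (simp add: trajectories_def)
  have vc: "v t \<in> carrier_vec n" for t unfolding v_def using wc by simp
  have vstep: "v (Suc t) = N *\<^sub>v v t" for t
  proof -
    have "N *\<^sub>v v t = ?h (inverse \<rho>) \<cdot>\<^sub>v (?h (inverse \<rho> ^ t) \<cdot>\<^sub>v (?M *\<^sub>v map_vec ?h (w t)))"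
      unfolding smult[OF vc] unfolding v_def using wc[of t] by (subst mult_mat_vec[OF cM]) auto
    also have "?M *\<^sub>v map_vec ?h (w t) = map_vec ?h (w (Suc t))"
      unfolding step using of_real_hom.mult_mat_vec_hom[OF M wc[of t]] by metis
    finally show ?thesis by (simp add: v_def smult_smult_assoc)
  qed
  have "(\<lambda>t. w t $ i) \<longlonglongrightarrow> 0" if i: "i < n" for i
  proof -
    \<comment> \<open>A bound on the components of \<open>v\<close> that is uniform in time, since
      the entries of every power of \<open>N\<close> have modulus at most \<open>c\<close>. Undoing
      the scaling turns it into \<open>K * \<rho> ^ t\<close> for \<open>w\<close>.\<close>
    define K where "K = (\<Sum>j<n. c * cmod (v 0 $ j))"
    have bound: "\<bar>w t $ i\<bar> \<le> K * \<rho> ^ t" for t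
    proof -
      have Nt: "N ^\<^sub>m t \<in> carrier_mat n n" using N by simp
      have "v t $ i = (\<Sum>j<n. (N ^\<^sub>m t) $$ (i, j) * v 0 $ j)"
        using linear_recurrence_pow[where w=v and t=t, OF N vc vstep] i carrier_matD[OF Nt] carrier_vecD[OF vc[of 0]]
        by (simp add: scalar_prod_def lessThan_atLeast0)
      then have "cmod (v t $ i) \<le> (\<Sum>j<n. cmod ((N ^\<^sub>m t) $$ (i, j) * v 0 $ j))"
        by (simp add: norm_sum)
      also have "\<dots> \<le> K" unfolding K_def norm_mult
        using c[of t] carrier_matD[OF Nt] i
        by (intro sum_mono mult_right_mono) (simp_all add: norm_bound_def del: pow_mat_dim)
      finally have "cmod (v t $ i) \<le> K" .
      moreover have "cmod (v t $ i) = inverse \<rho> ^ t * \<bar>w t $ i\<bar>"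
        unfolding v_def using i wc[of t] \<rho> by (simp add: norm_mult norm_power norm_inverse power_inverse)
      ultimately show ?thesis using \<rho> by (simp add: field_simps)
    qed
    have "(\<lambda>t. \<rho> ^ t) \<longlonglongrightarrow> 0" using \<rho> by (intro LIMSEQ_power_zero) auto
    moreover have "norm (w t $ i) \<le> norm (\<rho> ^ t) * K" for t
      using bound[of t] \<rho> by (simp add: mult.commute)
    ultimately show ?thesis by (rule tendsto_0_le[OF _ always_eventually[OF allI]])
  qed
  then show ?thesis using tends_to_zero_iff_components[OF w] by simp
qed

text \<open>For an eigenpair \<open>(k, v)\<close> the real and imaginary parts of \<open>k\<^sup>t v\<close> are real trajectories.\<close>

lemma tends_to_zero_imp_schur_stable:
  assumes M: "M \<in> carrier_mat n n"
    and lim: "\<And>w. w \<in> trajectories n \<Longrightarrow> (\<And>t. w (Suc t) = M *\<^sub>v w t) \<Longrightarrow> tends_to_zero w"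
  shows "schur_stable M"
  unfolding schur_stable_def
proof (intro allI impI)
  fix k
  let ?M = "map_mat complex_of_real M"
  assume "eigenvalue ?M k"
  then obtain v where v: "v \<in> carrier_vec n" "v \<noteq> 0\<^sub>v n" "?M *\<^sub>v v = k \<cdot>\<^sub>v v"
    using M by (auto simp: eigenvalue_def eigenvector_def)
  \<comment> \<open>A nonzero component of the eigenvector, by which \<open>k ^ t * v $ i\<close> is
    divided at the end to isolate \<open>k ^ t\<close>.\<close>
  from v(1,2) obtain i where i: "i < n" "v $ i \<noteq> 0"
    by (metis carrier_vecD eq_vecI index_zero_vec)
  have eig: "k * v $ j = (\<Sum>l<n. complex_of_real (M $$ (j, l)) * v $ l)" if "j < n" for j
    using arg_cong[OF v(3), of "\<lambda>u. u $ j"] that M v(1)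
    by (auto simp: scalar_prod_def lessThan_atLeast0)
  \<comment> \<open>\<open>f\<close> stands for \<open>Re\<close> or \<open>Im\<close>. Being
    additive and homogeneous over the reals, it commutes with the action of the real matrix
    \<open>M\<close>, so applying it to \<open>k ^ t * v\<close> gives a real trajectory of the
    recurrence.\<close>
  have part: "(\<lambda>t. f (k ^ t * v $ i)) \<longlonglongrightarrow> 0"
    if f: "\<And>g. f (\<Sum>l<n. g l) = (\<Sum>l<n. f (g l))" "\<And>a z. f (complex_of_real a * z) = a * f z"
    for f :: "complex \<Rightarrow> real"
  proof -
    define w where "w t = vec n (\<lambda>j. f (k ^ t * v $ j))" for t :: nat
    have w: "w \<in> trajectories n" by (simp add: w_def trajectories_def)
    have "w (Suc t) = M *\<^sub>v w t" for t
    proof (rule eq_vecI)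
      fix j assume "j < dim_vec (M *\<^sub>v w t)"
      then have j: "j < n" using M by simp
      have "k ^ Suc t * v $ j = (\<Sum>l<n. complex_of_real (M $$ (j, l)) * (k ^ t * v $ l))"
        unfolding power_Suc2 mult.assoc eig[OF j] sum_distrib_left by (simp add: mult.left_commute)
      then have "w (Suc t) $ j = (\<Sum>l<n. M $$ (j, l) * f (k ^ t * v $ l))"
        using j by (simp only: w_def index_vec f)
      then show "w (Suc t) $ j = (M *\<^sub>v w t) $ j"
        using j M by (auto simp: w_def scalar_prod_def lessThan_atLeast0)
    qed (use M in \<open>simp add: w_def\<close>)
    from lim[OF w this] i(1) show ?thesis
      by (simp add: tends_to_zero_iff_components[OF w]) (simp add: w_def)
  qed
  have "(\<lambda>t. Re (k ^ t * v $ i)) \<longlonglongrightarrow> 0" by (rule part) auto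
  moreover have "(\<lambda>t. Im (k ^ t * v $ i)) \<longlonglongrightarrow> 0" by (rule part) auto
  ultimately have "(\<lambda>t. k ^ t * v $ i) \<longlonglongrightarrow> 0" by (simp add: tendsto_complex_iff)
  then have "(\<lambda>t. k ^ t * v $ i * inverse (v $ i)) \<longlonglongrightarrow> 0" by (rule tendsto_mult_left_zero)
  then have "(\<lambda>t. k ^ t) \<longlonglongrightarrow> 0" using i(2) by (simp add: mult.assoc)
  then have "(\<lambda>t. cmod k ^ t) \<longlonglongrightarrow> 0" by (simp add: tendsto_norm_zero_iff flip: norm_power)
  \<comment> \<open>If \<open>cmod k\<close> were at least 1, all its powers would be too, and so
    would their limit 0.\<close>
  then show "cmod k < 1"
    using LIMSEQ_le_const[of "\<lambda>t. cmod k ^ t" 0 1] by (meson not_less one_le_power not_one_le_zero)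
qed

lemma acceptor_iff_proj3_subset:
  "acceptor A B C D E F AU Bu By Du Dy \<longleftrightarrow>
    proj3 (plant_behavior A B C D E F) \<subseteq> proj3 (observer_behavior AU Bu By Du Dy)"
  unfolding acceptor_def proj3_def by blast

lemma asymptotically_stable_error_behavior_iff:
  assumes M: "M \<in> carrier_mat n n"
  shows "asymptotically_stable (error_behavior M) \<longleftrightarrow> schur_stable M"
  unfolding asymptotically_stable_def error_behavior_eq[OF M]
  using schur_stable_imp_tends_to_zero[OF M] tends_to_zero_imp_schur_stable[OF M] by blast

section \<open>Products and equality of block matrices\<close>

text \<open>Block rows and block columns are 2 by 2 block matrices in which some blocks have no rows
  or no columns, so the general block product applies and the empty blocks contribute
  nothing.\<close>

lemma block_row_mult_append_rows:
  fixes X Y P Q :: "real mat"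
  assumes "X \<in> carrier_mat k a" "Y \<in> carrier_mat k b" "P \<in> carrier_mat a c" "Q \<in> carrier_mat b c"
  shows "block_row X Y * (P @\<^sub>r Q) = X * P + Y * Q"
proof -
  have "block_row X Y * (P @\<^sub>r Q)
      = four_block_mat (X * P + Y * Q) (X * 0\<^sub>m a 0 + Y * 0\<^sub>m b 0)
          (0\<^sub>m 0 a * P + 0\<^sub>m 0 b * Q) (0\<^sub>m 0 a * 0\<^sub>m a 0 + 0\<^sub>m 0 b * 0\<^sub>m b 0)"
    using mult_four_block_mat[of X k a Y b "0\<^sub>m 0 a" 0 "0\<^sub>m 0 b" P c "0\<^sub>m a 0" 0 Q "0\<^sub>m b 0"] assms
    by (simp add: block_row_def append_rows_def)
  also have "\<dots> = X * P + Y * Q" using assms by (intro eq_matI) auto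
  finally show ?thesis .
qed

lemma block_row_mult_four_block_mat:
  fixes X Y P Q R S :: "real mat"
  assumes "X \<in> carrier_mat k a" "Y \<in> carrier_mat k b"
    and "P \<in> carrier_mat a c" "Q \<in> carrier_mat a d" "R \<in> carrier_mat b c" "S \<in> carrier_mat b d"
  shows "block_row X Y * four_block_mat P Q R S = block_row (X * P + Y * R) (X * Q + Y * S)"
proof -
  have "block_row X Y * four_block_mat P Q R S
      = four_block_mat (X * P + Y * R) (X * Q + Y * S)
          (0\<^sub>m 0 a * P + 0\<^sub>m 0 b * R) (0\<^sub>m 0 a * Q + 0\<^sub>m 0 b * S)"
    using mult_four_block_mat[of X k a Y b "0\<^sub>m 0 a" 0 "0\<^sub>m 0 b" P c Q d R S] assms
    by (simp add: block_row_def)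
  also have "\<dots> = block_row (X * P + Y * R) (X * Q + Y * S)"
    unfolding block_row_def using assms by (intro cong_four_block_mat eq_matI) auto
  finally show ?thesis .
qed

lemma four_block_mat_mult_append_rows:
  fixes X Y Z W P Q :: "real mat"
  assumes "X \<in> carrier_mat k a" "Y \<in> carrier_mat k b" "Z \<in> carrier_mat l a" "W \<in> carrier_mat l b"
    and "P \<in> carrier_mat a c" "Q \<in> carrier_mat b c"
  shows "four_block_mat X Y Z W * (P @\<^sub>r Q) = (X * P + Y * Q) @\<^sub>r (Z * P + W * Q)"
proof -
  have "four_block_mat X Y Z W * (P @\<^sub>r Q)
      = four_block_mat (X * P + Y * Q) (X * 0\<^sub>m a 0 + Y * 0\<^sub>m b 0)
          (Z * P + W * Q) (Z * 0\<^sub>m a 0 + W * 0\<^sub>m b 0)"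
    using mult_four_block_mat[of X k a Y b Z l W P c "0\<^sub>m a 0" 0 Q "0\<^sub>m b 0"] assms
    by (simp add: append_rows_def)
  also have "\<dots> = (X * P + Y * Q) @\<^sub>r (Z * P + W * Q)"
    unfolding append_rows_def using assms by (intro cong_four_block_mat eq_matI) auto
  finally show ?thesis .
qed

text \<open>Corresponding blocks have the same size, so each block entry can be read off the whole
  matrix at an offset of \<open>k\<close> rows or \<open>a\<close> columns.\<close>

lemma four_block_mat_eq_iff:
  assumes "A \<in> carrier_mat k a" "B \<in> carrier_mat k b" "C \<in> carrier_mat l a" "D \<in> carrier_mat l b"
    and "A' \<in> carrier_mat k a" "B' \<in> carrier_mat k b" "C' \<in> carrier_mat l a" "D' \<in> carrier_mat l b"
  shows "four_block_mat A B C D = four_block_mat A' B' C' D' \<longleftrightarrow> A = A' \<and> B = B' \<and> C = C' \<and> D = D'"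
proof
  assume eq: "four_block_mat A B C D = four_block_mat A' B' C' D'"
  have entry: "four_block_mat A B C D $$ (i, j) = four_block_mat A' B' C' D' $$ (i, j)" for i j
    by (simp only: eq)
  have "A $$ (i, j) = A' $$ (i, j)" if "i < k" "j < a" for i j
    using entry[of i j] that assms by simp
  moreover have "B $$ (i, j) = B' $$ (i, j)" if "i < k" "j < b" for i j
    using entry[of i "j + a"] that assms by simp
  moreover have "C $$ (i, j) = C' $$ (i, j)" if "i < l" "j < a" for i j
    using entry[of "i + k" j] that assms by simp
  moreover have "D $$ (i, j) = D' $$ (i, j)" if "i < l" "j < b" for i j
    using entry[of "i + k" "j + a"] that assms by simp
  ultimately show "A = A' \<and> B = B' \<and> C = C' \<and> D = D'"
    using assms by (intro conjI eq_matI) auto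
qed simp

lemma block_row_eq_iff:
  assumes "X \<in> carrier_mat k a" "Y \<in> carrier_mat k b" "X' \<in> carrier_mat k a" "Y' \<in> carrier_mat k b"
  shows "block_row X Y = block_row X' Y' \<longleftrightarrow> X = X' \<and> Y = Y'"
  unfolding block_row_def using assms
  by (subst four_block_mat_eq_iff[of _ k a _ b _ 0]) auto

lemma append_rows_eq_iff:
  assumes "X \<in> carrier_mat k a" "Y \<in> carrier_mat l a" "X' \<in> carrier_mat k a" "Y' \<in> carrier_mat l a"
  shows "X @\<^sub>r Y = X' @\<^sub>r Y' \<longleftrightarrow> X = X' \<and> Y = Y'"
  unfolding append_rows_def using assms
  by (subst four_block_mat_eq_iff[of _ k a _ 0 _ l]) auto

text \<open>Unit vectors extract the columns. This is the passage between conditions on arbitrary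
  signal values and matrix equations.\<close>

lemma mat_eq_iff_mult_vec:
  fixes X Y :: "'a :: semiring_1 mat"
  assumes X: "X \<in> carrier_mat k a" and Y: "Y \<in> carrier_mat k a"
  shows "X = Y \<longleftrightarrow> (\<forall>v\<in>carrier_vec a. X *\<^sub>v v = Y *\<^sub>v v)"
proof
  assume eq: "\<forall>v\<in>carrier_vec a. X *\<^sub>v v = Y *\<^sub>v v"
  show "X = Y"
  proof (rule eq_matI)
    fix i j assume "i < dim_row Y" "j < dim_col Y"
    then have ij: "i < k" "j < a" using Y by auto
    then have "(X *\<^sub>v unit_vec a j) $ i = (Y *\<^sub>v unit_vec a j) $ i" using eq by simp
    then show "X $$ (i, j) = Y $$ (i, j)"
      using ij X Y by (simp add: scalar_prod_right_unit)
  qed (use X Y in auto)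
qed simp

lemma mult_mat_zero_vec:
  fixes M :: "'a :: semiring_0 mat"
  assumes "M \<in> carrier_mat l k"
  shows "M *\<^sub>v 0\<^sub>v k = 0\<^sub>v l"
  using assms by (intro eq_vecI) auto

section \<open>Estimation errors of an acceptor\<close>

locale plant_observer =
  fixes n m p r :: nat and A B C D E F AU Bu By Du Dy :: "real mat"
  assumes dims: "A \<in> carrier_mat n n" "B \<in> carrier_mat n m"
    "C \<in> carrier_mat p n" "D \<in> carrier_mat p m"
    "E \<in> carrier_mat n r" "F \<in> carrier_mat p r"
    "AU \<in> carrier_mat n n" "Bu \<in> carrier_mat n m" "By \<in> carrier_mat n p"
    "Du \<in> carrier_mat n m" "Dy \<in> carrier_mat n p"
begin

lemma UIO_iff_acceptor_stable:
  "unknown_input_observer A B C D E F AU Bu By Du Dy \<longleftrightarrow>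
    acceptor A B C D E F AU Bu By Du Dy \<and> asymptotically_stable (error_behavior AU)"
proof safe
  assume UIO: "unknown_input_observer A B C D E F AU Bu By Du Dy"
  then show "acceptor A B C D E F AU Bu By Du Dy" by (simp add: unknown_input_observer_def)
  show "asymptotically_stable (error_behavior AU)"
    unfolding asymptotically_stable_def
  proof
    fix w assume "w \<in> error_behavior AU"
    then have wc: "w t \<in> carrier_vec n" and w: "w (Suc t) = AU *\<^sub>v w t" for t
      by (auto simp: error_behavior_eq[OF dims(7)] trajectories_def)
    have "(\<lambda>t. 0\<^sub>v n, \<lambda>t. 0\<^sub>v m, \<lambda>t. 0\<^sub>v p, \<lambda>t. 0\<^sub>v r) \<in> plant_behavior A B C D E F"
      using dims by (auto simp: plant_behavior_def trajectories_def mult_mat_zero_vec[of _ n] mult_mat_zero_vec[of _ p])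
    \<comment> \<open>With zero input and output the estimate coincides with the observer state, so
      \<open>w\<close> serves as both; the error against the zero plant is \<open>- w\<close>, whose
      norm is that of \<open>w\<close>.\<close>
    moreover have "(w, \<lambda>t. 0\<^sub>v m, \<lambda>t. 0\<^sub>v p, w) \<in> observer_behavior AU Bu By Du Dy"
      using dims wc by (auto simp: observer_behavior_def trajectories_def w mult_mat_zero_vec[of _ n])
    ultimately have lim: "tends_to_zero (\<lambda>t. 0\<^sub>v n - w t)"
      using UIO unfolding unknown_input_observer_def by blast
    have "(0\<^sub>v n - w t) \<bullet> (0\<^sub>v n - w t) = w t \<bullet> w t" for t
      using carrier_vecD[OF wc[of t]] by (auto simp: scalar_prod_def)
    with lim show "tends_to_zero w" by (simp add: tends_to_zero_def)
  qed
next
  assume acc: "acceptor A B C D E F AU Bu By Du Dy"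
    and stable: "asymptotically_stable (error_behavior AU)"
  have "tends_to_zero (\<lambda>t. x t - xh t)"
    if plant: "(x, u, y, d) \<in> plant_behavior A B C D E F"
      and obs: "(xh, u, y, z) \<in> observer_behavior AU Bu By Du Dy" for x u y d xh z
  proof -
    \<comment> \<open>A second observer trajectory with the same \<open>u\<close> and
      \<open>y\<close> whose estimate is the plant state itself. In the difference
      \<open>z' - z\<close> all input and output terms cancel.\<close>
    from acc plant obtain z' where obs': "(x, u, y, z') \<in> observer_behavior AU Bu By Du Dy"
      unfolding acceptor_def by blast
    have c: "z t \<in> carrier_vec n" "z' t \<in> carrier_vec n" "u t \<in> carrier_vec m"
      "y t \<in> carrier_vec p" for t
      using obs obs' dims by (auto simp: observer_behavior_def trajectories_def)
    have step: "z (Suc t) = AU *\<^sub>v z t + Bu *\<^sub>v u t + By *\<^sub>v y t"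
      "z' (Suc t) = AU *\<^sub>v z' t + Bu *\<^sub>v u t + By *\<^sub>v y t" for t
      using obs obs' by (auto simp: observer_behavior_def)
    have err: "x t - xh t = z' t - z t" for t
      using obs obs' carrier_vecD[OF c(1)[of t]] carrier_vecD[OF c(2)[of t]] dims
      by (intro eq_vecI) (auto simp: observer_behavior_def)
    have "(\<lambda>t. z' t - z t) \<in> error_behavior AU"
      unfolding error_behavior_eq[OF dims(7)]
    proof (intro CollectI conjI allI)
      show "z' (Suc t) - z (Suc t) = AU *\<^sub>v (z' t - z t)" for t
        unfolding mult_minus_distrib_mat_vec[OF dims(7) c(2) c(1)] step
        using dims by (intro eq_vecI) auto
    qed (use c in \<open>simp add: trajectories_def\<close>)
    with stable show ?thesis unfolding err asymptotically_stable_def by blast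
  qed
  with acc show "unknown_input_observer A B C D E F AU Bu By Du Dy"
    unfolding unknown_input_observer_def by blast
qed


section \<open>The acceptor property as a condition on a single time step\<close>

definition plant_out where "plant_out x u d = C *\<^sub>v x + D *\<^sub>v u + F *\<^sub>v d"

definition plant_next where "plant_next x u d = A *\<^sub>v x + B *\<^sub>v u + E *\<^sub>v d"

definition obs_state where
  "obs_state x u d = x - (Du *\<^sub>v u + Dy *\<^sub>v plant_out x u d)"

lemma plant_carrier:
  assumes "x \<in> carrier_vec n" "u \<in> carrier_vec m" "d \<in> carrier_vec r"
  shows "plant_out x u d \<in> carrier_vec p" "plant_next x u d \<in> carrier_vec n"
    "obs_state x u d \<in> carrier_vec n"
proof -
  show "plant_out x u d \<in> carrier_vec p" "plant_next x u d \<in> carrier_vec n"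
    using dims assms by (auto simp: plant_out_def plant_next_def)
  then show "obs_state x u d \<in> carrier_vec n"
    using dims assms by (auto simp: obs_state_def)
qed

text \<open>\<open>obs_state\<close> is the only candidate for the observer state when the estimate equals the
  state. As \<open>u\<close> and \<open>d\<close> are arbitrary signals, their values \<open>u'\<close>, \<open>d'\<close> one step later are
  independent of \<open>x\<close>, \<open>u\<close>, \<open>d\<close>, which is what splits the acceptor property into five
  separate matrix equations.\<close>

definition accepts_step where
  "accepts_step x u d u' d' \<longleftrightarrow>
    obs_state (plant_next x u d) u' d' = AU *\<^sub>v obs_state x u d + Bu *\<^sub>v u + By *\<^sub>v plant_out x u d"

text \<open>Any five vectors occur as state, input and disturbance at time 0 and input and
  disturbance at time 1 of some plant trajectory, so acceptance forces the step condition.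
  Conversely, the step condition says that \<open>obs_state\<close> along a plant trajectory obeys
  the observer recursion.\<close>

lemma acceptor_iff_accepts_step:
  "acceptor A B C D E F AU Bu By Du Dy \<longleftrightarrow>
    (\<forall>x\<in>carrier_vec n. \<forall>u\<in>carrier_vec m. \<forall>d\<in>carrier_vec r. \<forall>u'\<in>carrier_vec m. \<forall>d'\<in>carrier_vec r.
      accepts_step x u d u' d')"
proof (intro iffI ballI)
  fix x u d u' d' :: "real vec"
  assume acc: "acceptor A B C D E F AU Bu By Du Dy"
    and c: "x \<in> carrier_vec n" "u \<in> carrier_vec m" "d \<in> carrier_vec r"
      "u' \<in> carrier_vec m" "d' \<in> carrier_vec r"
  \<comment> \<open>The prescribed values occupy times 0 and 1; the later values only extend the
    signal to all times.\<close>
  define us where "us t = (if t = 0 then u else u')" for t :: nat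
  define ds where "ds t = (if t = 0 then d else d')" for t :: nat
  define xs where "xs = rec_nat x (\<lambda>t x. plant_next x (us t) (ds t))"
  define ys where "ys t = plant_out (xs t) (us t) (ds t)" for t
  have xs: "xs 0 = x" "\<And>t. xs (Suc t) = plant_next (xs t) (us t) (ds t)" by (simp_all add: xs_def)
  have uc: "us t \<in> carrier_vec m" and dc: "ds t \<in> carrier_vec r" for t
    using c by (auto simp: us_def ds_def)
  have xc: "xs t \<in> carrier_vec n" for t
    by (induction t) (use c uc dc in \<open>auto simp: xs intro!: plant_carrier\<close>)
  have yc: "ys t \<in> carrier_vec p" for t unfolding ys_def by (intro plant_carrier xc uc dc)
  have "(xs, us, ys, ds) \<in> plant_behavior A B C D E F"
    using xc yc uc dc dims
    by (auto simp: plant_behavior_def trajectories_def xs plant_next_def ys_def plant_out_def)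
  with acc obtain zs where obs: "(xs, us, ys, zs) \<in> observer_behavior AU Bu By Du Dy"
    unfolding acceptor_def by blast
  have zc: "zs t \<in> carrier_vec n" for t
    using obs dims by (auto simp: observer_behavior_def trajectories_def)
  \<comment> \<open>The output equation with estimate \<open>xs\<close> leaves no freedom in the
    observer state. The recursion from time 0 to time 1 is then the claim.\<close>
  have zs: "zs t = obs_state (xs t) (us t) (ds t)" for t
  proof -
    have "xs t = zs t + Du *\<^sub>v us t + Dy *\<^sub>v ys t" using obs by (simp add: observer_behavior_def)
    then have "xs t $ i = zs t $ i + (Du *\<^sub>v us t) $ i + (Dy *\<^sub>v ys t) $ i" if "i < n" for i
      using that dims(10,11)[THEN carrier_matD(1)] by (simp del: index_mult_mat_vec)
    then show ?thesis unfolding obs_state_def ys_def[symmetric]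
      using carrier_vecD[OF zc] carrier_vecD[OF xc] dims(10,11)[THEN carrier_matD(1)]
      by (intro eq_vecI) (simp_all del: index_mult_mat_vec)
  qed
  have "zs (Suc 0) = AU *\<^sub>v zs 0 + Bu *\<^sub>v us 0 + By *\<^sub>v ys 0"
    using obs by (simp add: observer_behavior_def)
  then show "accepts_step x u d u' d'"
    unfolding zs ys_def accepts_step_def by (simp add: xs us_def ds_def)
next
  assume step: "\<forall>x\<in>carrier_vec n. \<forall>u\<in>carrier_vec m. \<forall>d\<in>carrier_vec r.
    \<forall>u'\<in>carrier_vec m. \<forall>d'\<in>carrier_vec r. accepts_step x u d u' d'"
  show "acceptor A B C D E F AU Bu By Du Dy"
    unfolding acceptor_def
  proof (intro allI impI exI)
    fix x u y d
    assume plant: "(x, u, y, d) \<in> plant_behavior A B C D E F"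
    let ?z = "\<lambda>t. obs_state (x t) (u t) (d t)"
    have c: "x t \<in> carrier_vec n" "u t \<in> carrier_vec m" "y t \<in> carrier_vec p"
      "d t \<in> carrier_vec r" for t
      using plant dims by (auto simp: plant_behavior_def trajectories_def)
    have eqs: "x (Suc t) = plant_next (x t) (u t) (d t)" "y t = plant_out (x t) (u t) (d t)" for t
      using plant by (auto simp: plant_behavior_def plant_next_def plant_out_def)
    have "?z (Suc t) = AU *\<^sub>v ?z t + Bu *\<^sub>v u t + By *\<^sub>v y t" for t
      using step c unfolding accepts_step_def by (simp add: eqs)
    moreover have "x t = ?z t + Du *\<^sub>v u t + Dy *\<^sub>v y t" for t
      unfolding obs_state_def eqs(2)[symmetric]
      using carrier_vecD[OF c(1)] dims(10,11)[THEN carrier_matD(1)]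
      by (intro eq_vecI) (simp_all del: index_mult_mat_vec)
    ultimately show "(x, u, y, ?z) \<in> observer_behavior AU Bu By Du Dy"
      using c dims by (auto simp: observer_behavior_def trajectories_def plant_carrier)
  qed
qed

section \<open>From the step condition to the matrix equations\<close>

text \<open>Linearity separates the contributions of the five vectors. With each product taken as an
  atom, only linear arithmetic on real components remains.\<close>

lemma accepts_step_iff_components:
  assumes c: "x \<in> carrier_vec n" "u \<in> carrier_vec m" "d \<in> carrier_vec r"
    "u' \<in> carrier_vec m" "d' \<in> carrier_vec r"
  shows "accepts_step x u d u' d' \<longleftrightarrow> (\<forall>i<n.
    (A *\<^sub>v x) $ i + (B *\<^sub>v u) $ i + (E *\<^sub>v d) $ i - (Du *\<^sub>v u') $ i
      - (Dy *\<^sub>v (C *\<^sub>v (A *\<^sub>v x))) $ i - (Dy *\<^sub>v (C *\<^sub>v (B *\<^sub>v u))) $ i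
      - (Dy *\<^sub>v (C *\<^sub>v (E *\<^sub>v d))) $ i - (Dy *\<^sub>v (D *\<^sub>v u')) $ i - (Dy *\<^sub>v (F *\<^sub>v d')) $ i
    = (AU *\<^sub>v x) $ i - (AU *\<^sub>v (Du *\<^sub>v u)) $ i - (AU *\<^sub>v (Dy *\<^sub>v (C *\<^sub>v x))) $ i
      - (AU *\<^sub>v (Dy *\<^sub>v (D *\<^sub>v u))) $ i - (AU *\<^sub>v (Dy *\<^sub>v (F *\<^sub>v d))) $ i
      + (Bu *\<^sub>v u) $ i
      + (By *\<^sub>v (C *\<^sub>v x)) $ i + (By *\<^sub>v (D *\<^sub>v u)) $ i + (By *\<^sub>v (F *\<^sub>v d)) $ i)"
    (is "_ \<longleftrightarrow> (\<forall>i<n. ?l i = ?r i)")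
proof -
  have add3: "M *\<^sub>v (v1 + v2 + v3) = M *\<^sub>v v1 + M *\<^sub>v v2 + M *\<^sub>v v3"
    if "M \<in> carrier_mat k l" "v1 \<in> carrier_vec l" "v2 \<in> carrier_vec l" "v3 \<in> carrier_vec l"
    for M :: "real mat" and k l v1 v2 v3
    unfolding mult_add_distrib_mat_vec[OF that(1) add_carrier_vec[OF that(2,3)] that(4)]
      mult_add_distrib_mat_vec[OF that(1-3)] ..
  note car = mult_mat_vec_carrier[OF dims(1)] mult_mat_vec_carrier[OF dims(2)]
    mult_mat_vec_carrier[OF dims(3)] mult_mat_vec_carrier[OF dims(4)]
    mult_mat_vec_carrier[OF dims(5)] mult_mat_vec_carrier[OF dims(6)]
    mult_mat_vec_carrier[OF dims(7)] mult_mat_vec_carrier[OF dims(8)]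
    mult_mat_vec_carrier[OF dims(9)] mult_mat_vec_carrier[OF dims(10)]
    mult_mat_vec_carrier[OF dims(11)]
  have y: "M *\<^sub>v plant_out v w e = M *\<^sub>v (C *\<^sub>v v) + M *\<^sub>v (D *\<^sub>v w) + M *\<^sub>v (F *\<^sub>v e)"
    if "M \<in> carrier_mat n p" "v \<in> carrier_vec n" "w \<in> carrier_vec m" "e \<in> carrier_vec r" for M v w e
    unfolding plant_out_def by (intro add3[OF that(1)] car that)
  have next_c: "plant_next x u d \<in> carrier_vec n" by (intro plant_carrier c)
  have "C *\<^sub>v plant_next x u d = C *\<^sub>v (A *\<^sub>v x) + C *\<^sub>v (B *\<^sub>v u) + C *\<^sub>v (E *\<^sub>v d)"
    unfolding plant_next_def by (intro add3[OF dims(3)] car c)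
  then have DyC: "Dy *\<^sub>v (C *\<^sub>v plant_next x u d) =
      Dy *\<^sub>v (C *\<^sub>v (A *\<^sub>v x)) + Dy *\<^sub>v (C *\<^sub>v (B *\<^sub>v u)) + Dy *\<^sub>v (C *\<^sub>v (E *\<^sub>v d))"
    by (simp only:) (intro add3[OF dims(11)] car c)
  have DuDy: "Du *\<^sub>v u \<in> carrier_vec n" "Dy *\<^sub>v plant_out x u d \<in> carrier_vec n"
    by (intro car plant_carrier c)+
  have "AU *\<^sub>v obs_state x u d = AU *\<^sub>v x - AU *\<^sub>v (Du *\<^sub>v u + Dy *\<^sub>v plant_out x u d)"
    unfolding obs_state_def
    by (intro mult_minus_distrib_mat_vec[OF dims(7)] c add_carrier_vec DuDy)
  also have "AU *\<^sub>v (Du *\<^sub>v u + Dy *\<^sub>v plant_out x u d)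
      = AU *\<^sub>v (Du *\<^sub>v u) + AU *\<^sub>v (Dy *\<^sub>v plant_out x u d)"
    by (intro mult_add_distrib_mat_vec[OF dims(7)] DuDy)
  also have "AU *\<^sub>v (Dy *\<^sub>v plant_out x u d) = AU *\<^sub>v (Dy *\<^sub>v (C *\<^sub>v x)) + AU *\<^sub>v (Dy *\<^sub>v (D *\<^sub>v u))
      + AU *\<^sub>v (Dy *\<^sub>v (F *\<^sub>v d))"
    unfolding y[OF dims(11) c(1-3)] by (intro add3[OF dims(7)] car c)
  finally have AUz: "AU *\<^sub>v obs_state x u d = AU *\<^sub>v x - (AU *\<^sub>v (Du *\<^sub>v u) +
      (AU *\<^sub>v (Dy *\<^sub>v (C *\<^sub>v x)) + AU *\<^sub>v (Dy *\<^sub>v (D *\<^sub>v u)) + AU *\<^sub>v (Dy *\<^sub>v (F *\<^sub>v d))))" .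
  have z': "obs_state (plant_next x u d) u' d' = A *\<^sub>v x + B *\<^sub>v u + E *\<^sub>v d - (Du *\<^sub>v u' +
      (Dy *\<^sub>v (C *\<^sub>v (A *\<^sub>v x)) + Dy *\<^sub>v (C *\<^sub>v (B *\<^sub>v u)) + Dy *\<^sub>v (C *\<^sub>v (E *\<^sub>v d))
        + Dy *\<^sub>v (D *\<^sub>v u') + Dy *\<^sub>v (F *\<^sub>v d')))"
    unfolding obs_state_def y[OF dims(11) next_c c(4,5)] DyC unfolding plant_next_def ..
  note rows = dims[THEN carrier_matD(1)]
  have lhs: "obs_state (plant_next x u d) u' d' $ i = ?l i" if "i < n" for i
    unfolding z' using that by (simp add: rows del: index_mult_mat_vec)
  have rhs: "(AU *\<^sub>v obs_state x u d + Bu *\<^sub>v u + By *\<^sub>v plant_out x u d) $ i = ?r i" if "i < n" for i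
    unfolding AUz y[OF dims(9) c(1-3)] using that by (simp add: rows del: index_mult_mat_vec)
  have "dim_vec (obs_state (plant_next x u d) u' d') = n"
    using plant_carrier(3)[OF next_c c(4,5)] by simp
  moreover have "dim_vec (AU *\<^sub>v obs_state x u d + Bu *\<^sub>v u + By *\<^sub>v plant_out x u d) = n"
    by (simp add: rows)
  ultimately show ?thesis
    unfolding accepts_step_def vec_eq_iff using lhs rhs by (simp del: index_mult_mat_vec index_add_vec)
qed

text \<open>The step condition is linear in five free vectors, so it is tested with all but one of
  them zero, and conversely the five identities add up to it. The conjuncts belong to
  \<open>d\<close>, \<open>d'\<close>, \<open>x\<close>, \<open>u\<close> and \<open>u'\<close>, in
  this order.\<close>

lemma accepts_step_iff_vec:
  "(\<forall>x\<in>carrier_vec n. \<forall>u\<in>carrier_vec m. \<forall>d\<in>carrier_vec r. \<forall>u'\<in>carrier_vec m. \<forall>d'\<in>carrier_vec r.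
      accepts_step x u d u' d') \<longleftrightarrow>
    (\<forall>d\<in>carrier_vec r. - (Dy *\<^sub>v (C *\<^sub>v (E *\<^sub>v d))) + (AU *\<^sub>v (Dy *\<^sub>v (F *\<^sub>v d)) - By *\<^sub>v (F *\<^sub>v d)) = - (E *\<^sub>v d)) \<and>
    (\<forall>d\<in>carrier_vec r. - (Dy *\<^sub>v (F *\<^sub>v d)) = 0\<^sub>v n) \<and>
    (\<forall>x\<in>carrier_vec n. AU *\<^sub>v x =
      A *\<^sub>v x + (- (Dy *\<^sub>v (C *\<^sub>v (A *\<^sub>v x))) + (AU *\<^sub>v (Dy *\<^sub>v (C *\<^sub>v x)) - By *\<^sub>v (C *\<^sub>v x)))) \<and>
    (\<forall>u\<in>carrier_vec m. Bu *\<^sub>v u = B *\<^sub>v u - Dy *\<^sub>v (C *\<^sub>v (B *\<^sub>v u)) - By *\<^sub>v (D *\<^sub>v u)) \<and>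
    (\<forall>u\<in>carrier_vec m. Du *\<^sub>v u = - (Dy *\<^sub>v (D *\<^sub>v u)))"
  (is "?L \<longleftrightarrow> ?R")
proof
  note zeros = dims[THEN mult_mat_zero_vec]
  note rows = dims[THEN carrier_matD(1)]
  {
    assume L: ?L
    have step: "accepts_step x u d u' d'"
      if "x \<in> carrier_vec n" "u \<in> carrier_vec m" "d \<in> carrier_vec r" "u' \<in> carrier_vec m"
        "d' \<in> carrier_vec r" for x u d u' d'
      using L that by blast
    note z = zero_carrier_vec
    show ?R
    proof (intro conjI ballI)
      fix d :: "real vec" assume d: "d \<in> carrier_vec r"
      have "(- (Dy *\<^sub>v (C *\<^sub>v (E *\<^sub>v d))) + (AU *\<^sub>v (Dy *\<^sub>v (F *\<^sub>v d)) - By *\<^sub>v (F *\<^sub>v d))) $ i = (- (E *\<^sub>v d)) $ i" if "i < n" for i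
        using step[OF z z d z z, unfolded accepts_step_iff_components[OF z z d z z] zeros,
          rule_format, OF that] that
        by (simp add: rows del: index_mult_mat_vec)
      then show "- (Dy *\<^sub>v (C *\<^sub>v (E *\<^sub>v d))) + (AU *\<^sub>v (Dy *\<^sub>v (F *\<^sub>v d)) - By *\<^sub>v (F *\<^sub>v d)) = - (E *\<^sub>v d)"
        by (intro eq_vecI) (simp_all add: rows del: index_mult_mat_vec)
      have "(- (Dy *\<^sub>v (F *\<^sub>v d))) $ i = 0\<^sub>v n $ i" if "i < n" for i
        using step[OF z z z z d, unfolded accepts_step_iff_components[OF z z z z d] zeros,
          rule_format, OF that] that
        by (simp add: rows del: index_mult_mat_vec)
      then show "- (Dy *\<^sub>v (F *\<^sub>v d)) = 0\<^sub>v n"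
        by (intro eq_vecI) (simp_all add: rows del: index_mult_mat_vec)
    next
      fix x :: "real vec" assume x: "x \<in> carrier_vec n"
      let ?rhs = "A *\<^sub>v x + (- (Dy *\<^sub>v (C *\<^sub>v (A *\<^sub>v x))) + (AU *\<^sub>v (Dy *\<^sub>v (C *\<^sub>v x)) - By *\<^sub>v (C *\<^sub>v x)))"
      have "(AU *\<^sub>v x) $ i = ?rhs $ i" if "i < n" for i
        using step[OF x z z z z, unfolded accepts_step_iff_components[OF x z z z z] zeros,
          rule_format, OF that] that
        by (simp add: rows del: index_mult_mat_vec)
      then show "AU *\<^sub>v x = ?rhs"
        by (intro eq_vecI) (simp_all add: rows del: index_mult_mat_vec)
    next
      fix u :: "real vec" assume u: "u \<in> carrier_vec m"
      have "(Du *\<^sub>v u) $ i = (- (Dy *\<^sub>v (D *\<^sub>v u))) $ i" if "i < n" for i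
        using step[OF z z z u z, unfolded accepts_step_iff_components[OF z z z u z] zeros,
          rule_format, OF that] that
        by (simp add: rows del: index_mult_mat_vec)
      then show Du: "Du *\<^sub>v u = - (Dy *\<^sub>v (D *\<^sub>v u))"
        by (intro eq_vecI) (simp_all add: rows del: index_mult_mat_vec)
      \<comment> \<open>The identity obtained from \<open>u'\<close> makes the two terms through
        \<open>AU\<close> in the contribution of \<open>u\<close> cancel, which leaves the formula
        for \<open>Bu\<close>.\<close>
      have AUu: "AU *\<^sub>v (Du *\<^sub>v u) = - (AU *\<^sub>v (Dy *\<^sub>v (D *\<^sub>v u)))"
        unfolding Du using dims u by (intro eq_vecI) auto
      have "(Bu *\<^sub>v u) $ i = (B *\<^sub>v u - Dy *\<^sub>v (C *\<^sub>v (B *\<^sub>v u)) - By *\<^sub>v (D *\<^sub>v u)) $ i" if "i < n" for i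
        using step[OF z u z z z, unfolded accepts_step_iff_components[OF z u z z z] zeros AUu,
          rule_format, OF that] that
        by (simp add: rows del: index_mult_mat_vec)
      then show "Bu *\<^sub>v u = B *\<^sub>v u - Dy *\<^sub>v (C *\<^sub>v (B *\<^sub>v u)) - By *\<^sub>v (D *\<^sub>v u)"
        by (intro eq_vecI) (simp_all add: rows del: index_mult_mat_vec)
    qed
  }
  assume R: ?R
  show ?L
  proof (intro ballI)
    fix x u d u' d' :: "real vec"
    assume c: "x \<in> carrier_vec n" "u \<in> carrier_vec m" "d \<in> carrier_vec r"
      "u' \<in> carrier_vec m" "d' \<in> carrier_vec r"
    from R c have V: "- (Dy *\<^sub>v (C *\<^sub>v (E *\<^sub>v d))) + (AU *\<^sub>v (Dy *\<^sub>v (F *\<^sub>v d)) - By *\<^sub>v (F *\<^sub>v d)) = - (E *\<^sub>v d)"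
      "- (Dy *\<^sub>v (F *\<^sub>v d')) = 0\<^sub>v n"
      "AU *\<^sub>v x =
        A *\<^sub>v x + (- (Dy *\<^sub>v (C *\<^sub>v (A *\<^sub>v x))) + (AU *\<^sub>v (Dy *\<^sub>v (C *\<^sub>v x)) - By *\<^sub>v (C *\<^sub>v x)))"
      "Bu *\<^sub>v u = B *\<^sub>v u - Dy *\<^sub>v (C *\<^sub>v (B *\<^sub>v u)) - By *\<^sub>v (D *\<^sub>v u)"
      "Du *\<^sub>v u' = - (Dy *\<^sub>v (D *\<^sub>v u'))" "Du *\<^sub>v u = - (Dy *\<^sub>v (D *\<^sub>v u))"
      by blast+
    \<comment> \<open>The \<open>Du\<close> identity enters at \<open>u'\<close> and also at
      \<open>u\<close>, where it cancels the terms through \<open>AU\<close>.\<close>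
    have AUu: "AU *\<^sub>v (Du *\<^sub>v u) = - (AU *\<^sub>v (Dy *\<^sub>v (D *\<^sub>v u)))"
      unfolding V(6) using dims c by (intro eq_vecI) auto
    show "accepts_step x u d u' d'"
      unfolding accepts_step_iff_components[OF c]
    proof (intro allI impI)
      fix i assume i: "i < n"
      show "(A *\<^sub>v x) $ i + (B *\<^sub>v u) $ i + (E *\<^sub>v d) $ i - (Du *\<^sub>v u') $ i
          - (Dy *\<^sub>v (C *\<^sub>v (A *\<^sub>v x))) $ i - (Dy *\<^sub>v (C *\<^sub>v (B *\<^sub>v u))) $ i
          - (Dy *\<^sub>v (C *\<^sub>v (E *\<^sub>v d))) $ i - (Dy *\<^sub>v (D *\<^sub>v u')) $ i - (Dy *\<^sub>v (F *\<^sub>v d')) $ i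
        = (AU *\<^sub>v x) $ i - (AU *\<^sub>v (Du *\<^sub>v u)) $ i - (AU *\<^sub>v (Dy *\<^sub>v (C *\<^sub>v x))) $ i
          - (AU *\<^sub>v (Dy *\<^sub>v (D *\<^sub>v u))) $ i - (AU *\<^sub>v (Dy *\<^sub>v (F *\<^sub>v d))) $ i
          + (Bu *\<^sub>v u) $ i
          + (By *\<^sub>v (C *\<^sub>v x)) $ i + (By *\<^sub>v (D *\<^sub>v u)) $ i + (By *\<^sub>v (F *\<^sub>v d)) $ i"
        using V(1-5)[THEN arg_cong, of "\<lambda>v. v $ i"] AUu[THEN arg_cong, of "\<lambda>v. v $ i"] i
        by (simp add: rows del: index_mult_mat_vec)
    qed
  qed
qed

text \<open>The two column blocks of the first equation encode the identities for \<open>d\<close>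
  and \<open>d'\<close>, the second equation the one for \<open>x\<close>, and the two row blocks of
  the third those for \<open>u\<close> and \<open>u'\<close>.\<close>

lemma acceptor_iff_matrix_equations:
  "acceptor A B C D E F AU Bu By Du Dy \<longleftrightarrow>
    block_row (- Dy) (AU * Dy - By) * four_block_mat (C * E) F F (0\<^sub>m p r)
      = block_row (- E) (0\<^sub>m n r) \<and>
    AU = A + block_row (- Dy) (AU * Dy - By) * ((C * A) @\<^sub>r C) \<and>
    Bu @\<^sub>r Du
      = four_block_mat (1\<^sub>m n - Dy * C) (- By) (0\<^sub>m n n) (- Dy) * (B @\<^sub>r D)"
proof -
  let ?H = "AU * Dy - By"
  have H: "?H \<in> carrier_mat n p" using dims by (intro minus_carrier_mat)
  have Hv: "?H *\<^sub>v v = AU *\<^sub>v (Dy *\<^sub>v v) - By *\<^sub>v v" if "v \<in> carrier_vec p" for v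
    unfolding minus_mult_distrib_mat_vec[OF mult_carrier_mat[OF dims(7,11)] dims(9) that]
      assoc_mult_mat_vec[OF dims(7,11) that] ..
  have neg: "- M *\<^sub>v v = - (M *\<^sub>v v)" if "M \<in> carrier_mat k l" "v \<in> carrier_vec l"
    for M :: "real mat" and k l v
    using that by (intro uminus_mult_mat_vec) auto
  have nDy: "- Dy \<in> carrier_mat n p" and nBy: "- By \<in> carrier_mat n p" and nE: "- E \<in> carrier_mat n r"
    using dims by simp_all
  have K: "1\<^sub>m n - Dy * C \<in> carrier_mat n n" using dims by (intro minus_carrier_mat mult_carrier_mat)
  note CE = mult_carrier_mat[OF dims(3,5)] and CA = mult_carrier_mat[OF dims(3,1)]
    and zpr = zero_carrier_mat[of p r] and znr = zero_carrier_mat[of n r] and znn = zero_carrier_mat[of n n]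
  note mv = mult_mat_vec_carrier
  have prod: "- Dy * M \<in> carrier_mat n k" "?H * M' \<in> carrier_mat n k" "- Dy * M + ?H * M' \<in> carrier_mat n k"
    if "M \<in> carrier_mat p k" "M' \<in> carrier_mat p k" for M M' k
    by (intro add_carrier_mat mult_carrier_mat[OF nDy] mult_carrier_mat[OF H] that)+
  \<comment> \<open>The common shape of the products with the block row: the pairs
    \<open>(M, M')\<close> are \<open>(C * E, F)\<close>, \<open>(F, 0\<^sub>m p r)\<close> and
    \<open>(C * A, C)\<close>.\<close>
  have prod_vec: "(- Dy * M + ?H * M') *\<^sub>v v
      = - (Dy *\<^sub>v (M *\<^sub>v v)) + (AU *\<^sub>v (Dy *\<^sub>v (M' *\<^sub>v v)) - By *\<^sub>v (M' *\<^sub>v v))"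
    if M: "M \<in> carrier_mat p k" "M' \<in> carrier_mat p k" and v: "v \<in> carrier_vec k" for M M' k v
    unfolding add_mult_distrib_mat_vec[OF prod(1,2)[OF M] v] assoc_mult_mat_vec[OF nDy M(1) v]
      assoc_mult_mat_vec[OF H M(2) v] neg[OF dims(11) mv[OF M(1) v]] Hv[OF mv[OF M(2) v]] ..
  have zv: "0\<^sub>m l k *\<^sub>v v = 0\<^sub>v l" if "v \<in> carrier_vec k" for v :: "real vec" and l k
    using that by (intro eq_vecI) auto
  have eq1: "block_row (- Dy) ?H * four_block_mat (C * E) F F (0\<^sub>m p r) = block_row (- E) (0\<^sub>m n r) \<longleftrightarrow>
      - Dy * (C * E) + ?H * F = - E \<and> - Dy * F + ?H * 0\<^sub>m p r = 0\<^sub>m n r"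
    unfolding block_row_mult_four_block_mat[OF nDy H CE dims(6) dims(6) zpr]
    by (rule block_row_eq_iff[OF prod(3)[OF CE dims(6)] prod(3)[OF dims(6) zpr] nE znr])
  have eq2: "- Dy * (C * E) + ?H * F = - E \<longleftrightarrow>
      (\<forall>d\<in>carrier_vec r. - (Dy *\<^sub>v (C *\<^sub>v (E *\<^sub>v d))) + (AU *\<^sub>v (Dy *\<^sub>v (F *\<^sub>v d)) - By *\<^sub>v (F *\<^sub>v d)) = - (E *\<^sub>v d))"
    unfolding mat_eq_iff_mult_vec[OF prod(3)[OF CE dims(6)] nE]
    by (intro ball_cong refl)
      (simp only: prod_vec[OF CE dims(6)] assoc_mult_mat_vec[OF dims(3,5)] neg[OF dims(5)])
  have eq3: "- Dy * F + ?H * 0\<^sub>m p r = 0\<^sub>m n r \<longleftrightarrow>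
      (\<forall>d\<in>carrier_vec r. - (Dy *\<^sub>v (F *\<^sub>v d)) = 0\<^sub>v n)"
  proof -
    have "(- Dy * F + ?H * 0\<^sub>m p r) *\<^sub>v d = - (Dy *\<^sub>v (F *\<^sub>v d))" if d: "d \<in> carrier_vec r" for d
    proof -
      have "- (Dy *\<^sub>v (F *\<^sub>v d)) \<in> carrier_vec n"
        using mv[OF dims(11) mv[OF dims(6) d]] by simp
      then show ?thesis
        unfolding prod_vec[OF dims(6) zpr d] zv[OF d] mult_mat_zero_vec[OF dims(11)] mult_mat_zero_vec[OF dims(7)] mult_mat_zero_vec[OF dims(9)]
        by simp
    qed
    then show ?thesis
      unfolding mat_eq_iff_mult_vec[OF prod(3)[OF dims(6) zpr] znr]
      by (intro ball_cong refl) (simp only: zv)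
  qed
  have eq4: "block_row (- Dy) ?H * ((C * A) @\<^sub>r C) = - Dy * (C * A) + ?H * C"
    by (rule block_row_mult_append_rows[OF nDy H CA dims(3)])
  have eq5: "AU = A + (- Dy * (C * A) + ?H * C) \<longleftrightarrow>
      (\<forall>x\<in>carrier_vec n. AU *\<^sub>v x =
        A *\<^sub>v x + (- (Dy *\<^sub>v (C *\<^sub>v (A *\<^sub>v x))) + (AU *\<^sub>v (Dy *\<^sub>v (C *\<^sub>v x)) - By *\<^sub>v (C *\<^sub>v x))))"
    unfolding mat_eq_iff_mult_vec[OF dims(7) add_carrier_mat[OF prod(3)[OF CA dims(3)]]]
    by (intro ball_cong refl)
      (simp only: add_mult_distrib_mat_vec[OF dims(1) prod(3)[OF CA dims(3)]]
        prod_vec[OF CA dims(3)] assoc_mult_mat_vec[OF dims(3,1)])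
  have eq6: "Bu @\<^sub>r Du = four_block_mat (1\<^sub>m n - Dy * C) (- By) (0\<^sub>m n n) (- Dy) * (B @\<^sub>r D) \<longleftrightarrow>
      Bu = (1\<^sub>m n - Dy * C) * B + - By * D \<and> Du = 0\<^sub>m n n * B + - Dy * D"
    unfolding four_block_mat_mult_append_rows[OF K nBy znn nDy dims(2,4)]
    by (rule append_rows_eq_iff[OF dims(8,10)])
      (intro add_carrier_mat mult_carrier_mat[OF nBy dims(4)] mult_carrier_mat[OF nDy dims(4)])+
  have eq7: "Bu = (1\<^sub>m n - Dy * C) * B + - By * D \<longleftrightarrow>
      (\<forall>u\<in>carrier_vec m. Bu *\<^sub>v u = B *\<^sub>v u - Dy *\<^sub>v (C *\<^sub>v (B *\<^sub>v u)) - By *\<^sub>v (D *\<^sub>v u))"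
  proof -
    have "((1\<^sub>m n - Dy * C) * B + - By * D) *\<^sub>v u
        = B *\<^sub>v u - Dy *\<^sub>v (C *\<^sub>v (B *\<^sub>v u)) - By *\<^sub>v (D *\<^sub>v u)" if u: "u \<in> carrier_vec m" for u
    proof -
      note Bu' = mv[OF dims(2) u]
      have "((1\<^sub>m n - Dy * C) * B + - By * D) *\<^sub>v u
          = B *\<^sub>v u - Dy *\<^sub>v (C *\<^sub>v (B *\<^sub>v u)) + - (By *\<^sub>v (D *\<^sub>v u))"
        unfolding add_mult_distrib_mat_vec[OF mult_carrier_mat[OF K dims(2)] mult_carrier_mat[OF nBy dims(4)] u]
          assoc_mult_mat_vec[OF K dims(2) u] assoc_mult_mat_vec[OF nBy dims(4) u]
          minus_mult_distrib_mat_vec[OF one_carrier_mat mult_carrier_mat[OF dims(11,3)] Bu']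
          one_mult_mat_vec[OF Bu'] assoc_mult_mat_vec[OF dims(11,3) Bu'] neg[OF dims(9) mv[OF dims(4) u]] ..
      then show ?thesis
        using dims[THEN carrier_matD(1)] by (simp add: vec_eq_iff del: index_mult_mat_vec)
    qed
    then show ?thesis
      unfolding mat_eq_iff_mult_vec[OF dims(8) add_carrier_mat[OF mult_carrier_mat[OF nBy dims(4)]]]
      by (intro ball_cong refl) (simp only:)
  qed
  have eq8: "Du = 0\<^sub>m n n * B + - Dy * D \<longleftrightarrow>
      (\<forall>u\<in>carrier_vec m. Du *\<^sub>v u = - (Dy *\<^sub>v (D *\<^sub>v u)))"
  proof -
    have *: "0\<^sub>m n n * B + - Dy * D = - Dy * D"
      using left_mult_zero_mat[OF dims(2)] left_add_zero_mat[OF mult_carrier_mat[OF nDy dims(4)]] by simp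
    show ?thesis
      unfolding * mat_eq_iff_mult_vec[OF dims(10) mult_carrier_mat[OF nDy dims(4)]]
      by (intro ball_cong refl) (simp only: assoc_mult_mat_vec[OF nDy dims(4)] neg[OF dims(11) mv[OF dims(4)]])
  qed
  show ?thesis
    by (simp only: acceptor_iff_accepts_step accepts_step_iff_vec eq1 eq2 eq3 eq4 eq5 eq6 eq7 eq8 conj_assoc)
qed

end

theorem theorem6:
  fixes n m p r :: nat
    and A B C D E F AU Bu By Du Dy :: "real mat"
  assumes "A \<in> carrier_mat n n" and "B \<in> carrier_mat n m"
    and "C \<in> carrier_mat p n" and "D \<in> carrier_mat p m"
    and "E \<in> carrier_mat n r" and "F \<in> carrier_mat p r"
    and "vec_space.rank (n + p) (E @\<^sub>r F) = r"
    and "AU \<in> carrier_mat n n"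
    and "Bu \<in> carrier_mat n m" and "By \<in> carrier_mat n p"
    and "Du \<in> carrier_mat n m" and "Dy \<in> carrier_mat n p"
  shows
    "(unknown_input_observer A B C D E F AU Bu By Du Dy \<longleftrightarrow>
        proj3 (plant_behavior A B C D E F) \<subseteq> proj3 (observer_behavior AU Bu By Du Dy) \<and>
        autonomous (error_behavior AU) \<and> asymptotically_stable (error_behavior AU)) \<and>
     (unknown_input_observer A B C D E F AU Bu By Du Dy \<longleftrightarrow>
        schur_stable AU \<and>
        block_row (- Dy) (AU * Dy - By) * four_block_mat (C * E) F F (0\<^sub>m p r)
          = block_row (- E) (0\<^sub>m n r) \<and>
        AU = A + block_row (- Dy) (AU * Dy - By) * ((C * A) @\<^sub>r C) \<and>
        Bu @\<^sub>r Du
          = four_block_mat (1\<^sub>m n - Dy * C) (- By) (0\<^sub>m n n) (- Dy) * (B @\<^sub>r D))"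
proof -
  interpret plant_observer n m p r A B C D E F AU Bu By Du Dy
    using assms by unfold_locales
  \<comment> \<open>All three facts become conjunctions of the matrix equations with the Schur
    property; autonomy is supplied by \<open>autonomous_error_behavior\<close>.\<close>
  show ?thesis
    unfolding UIO_iff_acceptor_stable acceptor_iff_proj3_subset[symmetric]
      asymptotically_stable_error_behavior_iff[OF dims(7)] acceptor_iff_matrix_equations
    using autonomous_error_behavior[OF dims(7)] by blast
qed

end
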